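(* Fix $\lambda\in\Lambda$, a matrix $B$ with $d_W$ columns, and a probability law $\mathsf M$ on weak-process sample paths $g$ such that $\Pi_\lambda(\cdot\mid g)$ is well defined for $\mathsf M$-almost every $g$. Then $t_\lambda$ is a Bayes rule: it minimizes $IPR_{\lambda,B,\mathsf M}$ among measurable finite-valued rules $t:g\mapsto t(g)\in\mathbb R^{d_W}$. For every such rule $t$, $$IPR_{\lambda,B,\mathsf M}(t)-IPR_{\lambda,B,\mathsf M}(t_\lambda)=\int\|B(t(g)-t_\lambda(g))\|^2\,\mathsf M(dg)\ge0,$$ with both sides interpreted in the extended sense (possibly $+\infty$). If $IPR_{\lambda,B,\mathsf M}(t)<\infty$, the identity is an ordinary finite equality.
   Context: $\mathcal W\subset\mathbb R^{d_W}$ is a compact set (the retained weak parameter space) and $\Lambda\subset[0,\bar\lambda]$ is compact. A weak-process sample path is a function $g:\mathcal W\to\mathbb R^{k_W}$; $W:\mathcal W\to\mathbb R^{k_W\times k_W}$ is a nonrandom, continuous, symmetric, uniformly positive definite weight function, and $Q(\alpha_W)=g(\alpha_W)'W(\alpha_W)g(\alpha_W)$. For each $\lambda\in\Lambda$, $\pi_\lambda$ is a Borel probability measure on $\mathcal W$ (the prior induced by the hierarchy, of the form $\pi_\lambda(d\alpha_W)\propto p_W^0(\alpha_W)r_\lambda(\alpha_W)\mu_W(d\alpha_W)$, where $\mu_W$ is a finite measure with full support on $\mathcal W$, $p_W^0$ is a baseline prior density, and $r_\lambda(\alpha_W)=\int_\Theta\exp(\lambda[q_{1,W}(\alpha_W,\theta)+q_{1,S}(\alpha_{S0},\theta)])\pi_\theta(d\theta)$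 for continuous pooling objectives $q_{1,W},q_{1,S}$, a fixed point $\alpha_{S0}$, compact $\Theta$, and a probability $\pi_\theta$ on $\Theta$). The weak quasi-posterior is $$\Pi_\lambda(d\alpha_W\mid g)=\frac{\exp[-Q(\alpha_W)/2]\,\pi_\lambda(d\alpha_W)}{\int_{\mathcal W}\exp[-Q(u)/2]\,\pi_\lambda(du)},\qquad t_\lambda(g)=\int_{\mathcal W}\alpha_W\,\Pi_\lambda(d\alpha_W\mid g).$$ For a measurable rule $t$, the integrated posterior risk is $$IPR_{\lambda,B,\mathsf M}(t)=\int\Bigl[\int_{\mathcal W}\|B(t(g)-\alpha_W)\|^2\,\Pi_\lambda(d\alpha_W\mid g)\Bigr]\mathsf M(dg),$$ an extended nonnegative integral. The maps $g\mapsto\Pi_\lambda(\cdot\mid g)$ and $g\mapsto t_\lambda(g)$ are taken to be measurable. *)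

theory Defs
  imports "HOL-Probability.Probability"
begin

definition normalized_density :: "'a measure \<Rightarrow> ('a \<Rightarrow> real) \<Rightarrow> 'a measure" where
  "normalized_density \<mu> f = density \<mu> (\<lambda>x. ennreal (f x) / (\<integral>\<^sup>+ y. ennreal (f y) \<partial>\<mu>))"

definition full_support_on :: "'a::topological_space set \<Rightarrow> 'a measure \<Rightarrow> bool" where
  "full_support_on S \<mu> \<longleftrightarrow> (\<forall>U. open U \<and> U \<inter> S \<noteq> {} \<longrightarrow> 0 < emeasure \<mu> (U \<inter> S))"

definition uniformly_pos_def_on :: "'a set \<Rightarrow> ('a \<Rightarrow> real^'k^'k) \<Rightarrow> bool" where
  "uniformly_pos_def_on S V \<longleftrightarrow> (\<exists>c>0. \<forall>a\<in>S. \<forall>x. c * (norm x)\<^sup>2 \<le> x \<bullet> (V a *v x))"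

text \<open>The factor \<open>r\<^sub>\<lambda>\<close> of the hierarchical prior, with pooling objectives \<open>qW\<close> and \<open>qS\<close>, and
  the prior \<open>\<pi>\<^sub>\<lambda>\<close> itself.\<close>

definition pooling_factor ::
  "'h measure \<Rightarrow> ('a \<Rightarrow> 'h \<Rightarrow> real) \<Rightarrow> ('s \<Rightarrow> 'h \<Rightarrow> real) \<Rightarrow> 's \<Rightarrow> real \<Rightarrow> 'a \<Rightarrow> real" where
  "pooling_factor \<pi>\<theta> qW qS \<alpha>S lam a = (\<integral>\<theta>. exp (lam * (qW a \<theta> + qS \<alpha>S \<theta>)) \<partial>\<pi>\<theta>)"

definition weak_prior ::
  "'a measure \<Rightarrow> ('a \<Rightarrow> real) \<Rightarrow> 'h measure \<Rightarrow> ('a \<Rightarrow> 'h \<Rightarrow> real) \<Rightarrow> ('s \<Rightarrow> 'h \<Rightarrow> real) \<Rightarrow> 's \<Rightarrow>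
   real \<Rightarrow> 'a measure" where
  "weak_prior \<mu> p0 \<pi>\<theta> qW qS \<alpha>S lam =
     normalized_density \<mu> (\<lambda>a. p0 a * pooling_factor \<pi>\<theta> qW qS \<alpha>S lam a)"

definition quad_obj :: "('a \<Rightarrow> real^'k^'k) \<Rightarrow> ('a \<Rightarrow> real^'k) \<Rightarrow> 'a \<Rightarrow> real" where
  "quad_obj V g a = g a \<bullet> (V a *v g a)"

definition posterior_well_defined ::
  "('a \<Rightarrow> real^'k^'k) \<Rightarrow> 'a measure \<Rightarrow> ('a \<Rightarrow> real^'k) \<Rightarrow> bool" where
  "posterior_well_defined V \<pi> g \<longleftrightarrow>
     (\<lambda>a. exp (- quad_obj V g a / 2)) \<in> borel_measurable \<pi> \<and>
     0 < (\<integral>\<^sup>+ a. ennreal (exp (- quad_obj V g a / 2)) \<partial>\<pi>) \<and>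
     (\<integral>\<^sup>+ a. ennreal (exp (- quad_obj V g a / 2)) \<partial>\<pi>) < \<infinity>"

text \<open>Paths for which the defining formula is meaningless (for example non-measurable ones) are
  sent to the prior. This makes the quasi-posterior a probability measure for every path, so that
  its measurability can be expressed with \<^const>\<open>prob_algebra\<close>.\<close>

definition quasi_posterior ::
  "('a \<Rightarrow> real^'k^'k) \<Rightarrow> 'a measure \<Rightarrow> ('a \<Rightarrow> real^'k) \<Rightarrow> 'a measure" where
  "quasi_posterior V \<pi> g =
     (if posterior_well_defined V \<pi> g
      then normalized_density \<pi> (\<lambda>a. exp (- quad_obj V g a / 2)) else \<pi>)"

definition posterior_mean ::
  "(real^'d \<Rightarrow> real^'k^'k) \<Rightarrow> (real^'d) measure \<Rightarrow> (real^'d \<Rightarrow> real^'k) \<Rightarrow> real^'d" where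
  "posterior_mean V \<pi> g = (\<integral>a. a \<partial>quasi_posterior V \<pi> g)"

definition IPR ::
  "(real^'d \<Rightarrow> real^'k^'k) \<Rightarrow> (real^'d) measure \<Rightarrow> real^'d^'m \<Rightarrow> (real^'d \<Rightarrow> real^'k) measure \<Rightarrow>
   ((real^'d \<Rightarrow> real^'k) \<Rightarrow> real^'d) \<Rightarrow> ennreal" where
  "IPR V \<pi> B M t =
     (\<integral>\<^sup>+ g. (\<integral>\<^sup>+ a. ennreal ((norm (B *v (t g - a)))\<^sup>2) \<partial>quasi_posterior V \<pi> g) \<partial>M)"

definition is_Bayes_rule ::
  "(real^'d \<Rightarrow> real^'k^'k) \<Rightarrow> (real^'d) measure \<Rightarrow> real^'d^'m \<Rightarrow> (real^'d \<Rightarrow> real^'k) measure \<Rightarrow>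
   ((real^'d \<Rightarrow> real^'k) \<Rightarrow> real^'d) \<Rightarrow> bool" where
  "is_Bayes_rule V \<pi> B M t \<longleftrightarrow>
     t \<in> borel_measurable M \<and> (\<forall>s\<in>borel_measurable M. IPR V \<pi> B M t \<le> IPR V \<pi> B M s)"

end

theory Submission
  imports Defs
begin

text \<open>For each path the posterior is a probability on a bounded set, so the squared loss of an action
  decomposes into the squared distance of its image to that of the posterior mean plus the risk of the
  posterior mean, because the cross term integrates to zero. This second part is bounded uniformly in
  the path. Integrating over paths gives the risk identity with a finite subtrahend.\<close>

text \<open>Posteriors carry the trace sigma-algebra of \<open>S\<close> rather than the Borel sets
  of the whole space; integrands that are Borel on the whole space enter through this
  transfer.\<close>

lemma borel_measurable_of_sets_restrict:
  fixes f :: "'a::topological_space \<Rightarrow> 'b::topological_space"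
  assumes "sets N = sets (restrict_space borel S)" and "f \<in> borel_measurable borel"
  shows "f \<in> borel_measurable N"
  using assms measurable_cong_sets[OF assms(1) refl] measurable_restrict_space1 by blast

text \<open>On a probability space a uniform bound is itself integrable and equals its own mean. The
  first part supplies all integrability below; the second keeps posterior means in any closed
  centred ball containing the support set.\<close>

lemma norm_lebesgue_integral_le:
  fixes f :: "'a \<Rightarrow> 'b::{banach, second_countable_topology}"
  assumes "prob_space N" and "f \<in> borel_measurable N" and "\<And>x. x \<in> space N \<Longrightarrow> norm (f x) \<le> R"
  shows "integrable N f" and "norm (\<integral>x. f x \<partial>N) \<le> R"
proof -
  interpret prob_space N by fact
  show int: "integrable N f"
    using assms by (intro integrable_const_bound[where B = R]) auto
  have "norm (\<integral>x. f x \<partial>N) \<le> (\<integral>x. norm (f x) \<partial>N)"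
    by (rule integral_norm_bound)
  also have "\<dots> \<le> R"
    using int assms(3) by (intro integral_le_const) auto
  finally show "norm (\<integral>x. f x \<partial>N) \<le> R" .
qed

text \<open>Boundedness of \<open>S\<close> makes every integrand bounded, so the square can be
  expanded under real-valued integrals, where the signed cross term makes sense, and converted to
  \<open>ennreal\<close> only at the end.\<close>

lemma expected_square_loss_decomposition:
  fixes S :: "'a::euclidean_space set" and T :: "'a \<Rightarrow> 'b::euclidean_space"
  assumes "bounded_linear T" and "bounded S"
    and "prob_space N" and sets: "sets N = sets (restrict_space borel S)"
  defines "m \<equiv> \<integral>a. a \<partial>N"
  shows "(\<integral>\<^sup>+ a. ennreal ((norm (T (x - a)))\<^sup>2) \<partial>N)
    = ennreal ((norm (T (x - m)))\<^sup>2) + (\<integral>\<^sup>+ a. ennreal ((norm (T (m - a)))\<^sup>2) \<partial>N)"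
proof -
  interpret T: bounded_linear T by fact
  interpret prob_space N by fact
  have T_meas[measurable]: "T \<in> borel_measurable borel"
    by (intro borel_measurable_continuous_onI T.continuous_on continuous_on_id)
  have space: "space N = S"
    using sets_eq_imp_space_eq[OF sets] by (simp add: space_restrict_space)
  obtain R where R: "\<And>a. a \<in> S \<Longrightarrow> norm a \<le> R"
    using \<open>bounded S\<close> by (auto simp: bounded_iff)
  have id_int: "integrable N (\<lambda>a. a)"
    using R space by (intro norm_lebesgue_integral_le(1)[OF \<open>prob_space N\<close>, where R = R]
        borel_measurable_of_sets_restrict[OF sets]) auto
  \<comment> \<open>Here \<open>K\<close> is an operator bound of \<open>T\<close>, and
    \<open>y - a\<close> has norm at most \<open>norm y + R\<close> for \<open>a\<close> in
    \<open>S\<close>. The fact is used for \<open>y = x\<close> and \<open>y = m\<close>.\<close>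
  have sq_int: "integrable N (\<lambda>a. (norm (T (y - a)))\<^sup>2)" for y
  proof -
    obtain K where K: "\<And>a. norm (T a) \<le> norm a * K" "0 \<le> K"
      using T.nonneg_bounded by blast
    have "norm (T (y - a)) \<le> (norm y + R) * K" if "a \<in> S" for a
    proof -
      have "norm (y - a) \<le> norm y + R"
        using R[OF that] norm_triangle_ineq4[of y a] by linarith
      then show ?thesis
        using K(1)[of "y - a"] mult_right_mono[OF _ K(2)] order_trans by blast
    qed
    then show ?thesis
      using space by (intro norm_lebesgue_integral_le(1)[OF \<open>prob_space N\<close>, where R = "((norm y + R) * K)\<^sup>2"]
        borel_measurable_of_sets_restrict[OF sets]) (auto intro: power_mono)
  qed
  have lin_int: "integrable N (\<lambda>a. T (m - a))"
    using id_int by (intro integrable_bounded_linear[OF T.bounded_linear_axioms]) auto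
  have "(\<integral>a. T (m - a) \<partial>N) = T (\<integral>a. m - a \<partial>N)"
    using id_int by (intro integral_bounded_linear[OF T.bounded_linear_axioms]) auto
  also have "\<dots> = 0"
    using id_int by (simp add: m_def T.zero prob_space)
  finally have mean0: "(\<integral>a. T (m - a) \<partial>N) = 0" .
  have eq: "(norm (T (x - a)))\<^sup>2
      = (norm (T (x - m)))\<^sup>2 + (2 * (T (x - m) \<bullet> T (m - a)) + (norm (T (m - a)))\<^sup>2)" for a
  proof -
    have "T (x - a) = T (x - m) + T (m - a)"
      by (simp flip: T.add)
    then show ?thesis
      by (simp add: power2_norm_eq_inner inner_add_left inner_add_right inner_commute)
  qed
  have "(\<integral>a. (norm (T (x - a)))\<^sup>2 \<partial>N)
      = (\<integral>a. (norm (T (x - m)))\<^sup>2 + (2 * (T (x - m) \<bullet> T (m - a)) + (norm (T (m - a)))\<^sup>2) \<partial>N)"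
    by (rule Bochner_Integration.integral_cong[OF refl eq])
  \<comment> \<open>The factor \<open>T (x - m)\<close> does not depend on \<open>a\<close>, so the
    cross term integrates to its inner product with the zero of \<open>mean0\<close>; total mass one
    preserves the constant term.\<close>
  also have "\<dots> = (norm (T (x - m)))\<^sup>2 + (\<integral>a. (norm (T (m - a)))\<^sup>2 \<partial>N)"
    using lin_int sq_int[of m] by (simp add: mean0 prob_space)
  finally have "(\<integral>a. (norm (T (x - a)))\<^sup>2 \<partial>N)
      = (norm (T (x - m)))\<^sup>2 + (\<integral>a. (norm (T (m - a)))\<^sup>2 \<partial>N)" .
  then show ?thesis
    by (simp add: nn_integral_eq_integral sq_int flip: ennreal_plus)
qed

text \<open>The fixed-path identity is integrated over \<open>g\<close>; splitting the outer
  integral needs both summands measurable, which is where measurability of the kernel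
  \<open>q\<close> enters. Nothing bounds \<open>t\<close>, so both sides may be infinite.\<close>

lemma integrated_square_loss_decomposition:
  fixes S :: "'a::euclidean_space set" and T :: "'a \<Rightarrow> 'b::euclidean_space"
  assumes "bounded_linear T" and "bounded S"
    and q: "q \<in> M \<rightarrow>\<^sub>M prob_algebra (restrict_space borel S)"
    and m: "m = (\<lambda>g. \<integral>a. a \<partial>q g)" and [measurable]: "m \<in> borel_measurable M"
    and [measurable]: "t \<in> borel_measurable M"
  shows "(\<integral>\<^sup>+ g. (\<integral>\<^sup>+ a. ennreal ((norm (T (t g - a)))\<^sup>2) \<partial>q g) \<partial>M)
    = (\<integral>\<^sup>+ g. ennreal ((norm (T (t g - m g)))\<^sup>2) \<partial>M)
      + (\<integral>\<^sup>+ g. (\<integral>\<^sup>+ a. ennreal ((norm (T (m g - a)))\<^sup>2) \<partial>q g) \<partial>M)"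
proof -
  interpret T: bounded_linear T by fact
  have [measurable]: "T \<in> borel_measurable borel"
    by (intro borel_measurable_continuous_onI T.continuous_on continuous_on_id)
  have [measurable]: "(\<lambda>a. a) \<in> restrict_space borel S \<rightarrow>\<^sub>M borel"
    by (rule borel_measurable_of_sets_restrict[OF refl]) simp
  have q': "q \<in> M \<rightarrow>\<^sub>M subprob_algebra (restrict_space borel S)"
    using q by (rule measurable_prob_algebraD)
  have [measurable]: "(\<lambda>g. \<integral>\<^sup>+ a. ennreal ((norm (T (m g - a)))\<^sup>2) \<partial>q g) \<in> borel_measurable M"
    \<comment> \<open>The path enters through both \<open>m g\<close> and \<open>q g\<close>, so the
      rule asks for joint measurability of the loss in the pair of \<open>g\<close> and
      \<open>a\<close>.\<close>
    by (rule nn_integral_measurable_subprob_algebra2[OF _ q']) measurable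
  have "(\<integral>\<^sup>+ g. (\<integral>\<^sup>+ a. ennreal ((norm (T (t g - a)))\<^sup>2) \<partial>q g) \<partial>M)
    = (\<integral>\<^sup>+ g. ennreal ((norm (T (t g - m g)))\<^sup>2)
        + (\<integral>\<^sup>+ a. ennreal ((norm (T (m g - a)))\<^sup>2) \<partial>q g) \<partial>M)"
  \<comment> \<open>The equality holds at every path, not just almost everywhere, since each
    \<open>q g\<close> is a probability measure on \<open>S\<close>.\<close>
  proof (rule nn_integral_cong)
    fix g assume "g \<in> space M"
    then have "q g \<in> space (prob_algebra (restrict_space borel S))"
      by (rule measurable_space[OF q])
    then have "prob_space (q g)" "sets (q g) = sets (restrict_space borel S)"
      by (auto simp: space_prob_algebra)
    then show "(\<integral>\<^sup>+ a. ennreal ((norm (T (t g - a)))\<^sup>2) \<partial>q g)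
      = ennreal ((norm (T (t g - m g)))\<^sup>2) + (\<integral>\<^sup>+ a. ennreal ((norm (T (m g - a)))\<^sup>2) \<partial>q g)"
      unfolding m by (rule expected_square_loss_decomposition[OF assms(1,2)])
  qed
  then show ?thesis
    by (simp add: nn_integral_add)
qed

text \<open>The mean and the points of \<open>S\<close> all lie in the ball of radius
  \<open>R\<close>, hence within \<open>R + R\<close> of each other. With operator bound
  \<open>K\<close> this bounds the inner risk by a constant free of \<open>g\<close>, and
  \<open>M\<close> has mass one.\<close>

lemma integrated_square_loss_mean_finite:
  fixes S :: "'a::euclidean_space set" and T :: "'a \<Rightarrow> 'b::euclidean_space"
  assumes "bounded_linear T" and "bounded S" and "prob_space M"
    and q: "q \<in> M \<rightarrow>\<^sub>M prob_algebra (restrict_space borel S)"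
  shows "(\<integral>\<^sup>+ g. (\<integral>\<^sup>+ a. ennreal ((norm (T ((\<integral>a. a \<partial>q g) - a)))\<^sup>2) \<partial>q g) \<partial>M) < \<infinity>"
proof -
  interpret T: bounded_linear T by fact
  interpret prob_space M by fact
  obtain R where R: "\<And>a. a \<in> S \<Longrightarrow> norm a \<le> R"
    using \<open>bounded S\<close> by (auto simp: bounded_iff)
  obtain K where K: "\<And>a. norm (T a) \<le> norm a * K" "0 \<le> K"
    using T.nonneg_bounded by blast
  define C where "C = ennreal (((R + R) * K)\<^sup>2)"
  have inner: "(\<integral>\<^sup>+ a. ennreal ((norm (T ((\<integral>a. a \<partial>q g) - a)))\<^sup>2) \<partial>q g) \<le> C"
    if "g \<in> space M" for g
  proof -
    have "q g \<in> space (prob_algebra (restrict_space borel S))"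
      using measurable_space[OF q that] .
    then have prob: "prob_space (q g)" and sets: "sets (q g) = sets (restrict_space borel S)"
      by (auto simp: space_prob_algebra)
    interpret q: prob_space "q g" by fact
    have space: "space (q g) = S"
      using sets_eq_imp_space_eq[OF sets] by (simp add: space_restrict_space)
    define m where "m = (\<integral>a. a \<partial>q g)"
    have "norm m \<le> R"
      unfolding m_def using R space
      by (intro norm_lebesgue_integral_le(2)[OF prob] borel_measurable_of_sets_restrict[OF sets]) auto
    have "norm (T (m - a)) \<le> (R + R) * K" if "a \<in> S" for a
    proof -
      have "norm (m - a) \<le> R + R"
        using \<open>norm m \<le> R\<close> R[OF that] norm_triangle_ineq4[of m a] by linarith
      then show ?thesis
        using K(1)[of "m - a"] mult_right_mono[OF _ K(2)] order_trans by blast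
    qed
    then have "(\<integral>\<^sup>+ a. ennreal ((norm (T (m - a)))\<^sup>2) \<partial>q g) \<le> (\<integral>\<^sup>+ a. C \<partial>q g)"
      unfolding C_def using space by (intro nn_integral_mono ennreal_leI power_mono) auto
    then show ?thesis
      by (simp add: m_def q.emeasure_space_1)
  qed
  have "(\<integral>\<^sup>+ g. (\<integral>\<^sup>+ a. ennreal ((norm (T ((\<integral>a. a \<partial>q g) - a)))\<^sup>2) \<partial>q g) \<partial>M) \<le> (\<integral>\<^sup>+ g. C \<partial>M)"
    by (intro nn_integral_mono inner)
  also have "\<dots> < \<infinity>"
    by (simp add: C_def emeasure_space_1)
  finally show ?thesis .
qed

text \<open>Only the subtrahend has to be finite: for infinite \<open>x\<close> both sides are
  infinite. Differences are taken in \<open>ereal\<close> because subtraction in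
  \<open>ennreal\<close> truncates at zero.\<close>

lemma enn2ereal_add_diff_cancel:
  "y < \<infinity> \<Longrightarrow> enn2ereal (x + y) - enn2ereal y = enn2ereal x"
  by (cases x; cases y) (auto simp: enn2ereal_ennreal simp flip: ennreal_plus)

theorem proposition3p4:
  fixes W :: "(real^'d) set"
    and lam_bar lam :: real and Lam :: "real set"
    and V :: "real^'d \<Rightarrow> real^'k^'k"
    and \<mu> :: "(real^'d) measure" and p0 :: "real^'d \<Rightarrow> real"
    and \<Theta> :: "'h::{metric_space,second_countable_topology} set" and \<pi>\<theta> :: "'h measure"
    and qW :: "real^'d \<Rightarrow> 'h \<Rightarrow> real"
    and AS :: "'s::topological_space set" and \<alpha>S :: "'s"
    and qS :: "'s \<Rightarrow> 'h \<Rightarrow> real"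
    and \<pi> :: "real \<Rightarrow> (real^'d) measure"
    and B :: "real^'d^'m"
    and M :: "(real^'d \<Rightarrow> real^'k) measure"
  assumes "compact W"
    and "compact Lam" and "Lam \<subseteq> {0..lam_bar}"
    and "continuous_on W V"
    and "\<forall>a\<in>W. transpose (V a) = V a"
    and "uniformly_pos_def_on W V"
    and "sets \<mu> = sets (restrict_space borel W)" and "finite_measure \<mu>"
    and "full_support_on W \<mu>"
    and "p0 \<in> borel_measurable \<mu>" and "\<forall>a\<in>W. 0 \<le> p0 a" and "prob_space (density \<mu> (\<lambda>a. ennreal (p0 a)))"
    and "compact \<Theta>"
    and "sets \<pi>\<theta> = sets (restrict_space borel \<Theta>)" and "prob_space \<pi>\<theta>"
    and "continuous_on (W \<times> \<Theta>) (\<lambda>(a, \<theta>). qW a \<theta>)"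
    and "continuous_on (AS \<times> \<Theta>) (\<lambda>(s, \<theta>). qS s \<theta>)" and "\<alpha>S \<in> AS"
    and "\<pi> = weak_prior \<mu> p0 \<pi>\<theta> qW qS \<alpha>S"
    and "lam \<in> Lam"
    and "prob_space M" and "space M \<subseteq> (W \<rightarrow>\<^sub>E UNIV)"
    and "AE g in M. posterior_well_defined V (\<pi> lam) g"
    and "quasi_posterior V (\<pi> lam) \<in> M \<rightarrow>\<^sub>M prob_algebra (restrict_space borel W)"
    and "posterior_mean V (\<pi> lam) \<in> borel_measurable M"
  shows "is_Bayes_rule V (\<pi> lam) B M (posterior_mean V (\<pi> lam)) \<and>
    IPR V (\<pi> lam) B M (posterior_mean V (\<pi> lam)) < \<infinity> \<and>
    (\<forall>t\<in>borel_measurable M.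
      enn2ereal (IPR V (\<pi> lam) B M t) - enn2ereal (IPR V (\<pi> lam) B M (posterior_mean V (\<pi> lam)))
        = enn2ereal (\<integral>\<^sup>+ g. ennreal ((norm (B *v (t g - posterior_mean V (\<pi> lam) g)))\<^sup>2) \<partial>M) \<and>
      0 \<le> enn2ereal (IPR V (\<pi> lam) B M t)
            - enn2ereal (IPR V (\<pi> lam) B M (posterior_mean V (\<pi> lam))) \<and>
      (IPR V (\<pi> lam) B M t < \<infinity> \<longrightarrow>
        integrable M (\<lambda>g. (norm (B *v (t g - posterior_mean V (\<pi> lam) g)))\<^sup>2) \<and>
        enn2real (IPR V (\<pi> lam) B M t) - enn2real (IPR V (\<pi> lam) B M (posterior_mean V (\<pi> lam)))
          = (\<integral>g. (norm (B *v (t g - posterior_mean V (\<pi> lam) g)))\<^sup>2 \<partial>M)))"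
proof -
  let ?q = "quasi_posterior V (\<pi> lam)" and ?m = "posterior_mean V (\<pi> lam)"
  let ?R = "IPR V (\<pi> lam) B M"
  let ?E = "\<lambda>t. \<integral>\<^sup>+ g. ennreal ((norm (B *v (t g - ?m g)))\<^sup>2) \<partial>M"
  have lin: "bounded_linear ((*v) B)"
    by (rule matrix_vector_mul_bounded_linear)
  have bdd: "bounded W"
    using \<open>compact W\<close> by (rule compact_imp_bounded)
  note q = \<open>?q \<in> M \<rightarrow>\<^sub>M prob_algebra (restrict_space borel W)\<close>
  note m_meas = \<open>?m \<in> borel_measurable M\<close>
  have m: "?m = (\<lambda>g. \<integral>a. a \<partial>?q g)"
    by (simp add: posterior_mean_def fun_eq_iff)
  \<comment> \<open>The additive form involves no subtraction and is valid for rules of infinite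
    risk; all remaining claims are read off from it.\<close>
  have decomp: "?R t = ?E t + ?R ?m" if "t \<in> borel_measurable M" for t
    unfolding IPR_def by (rule integrated_square_loss_decomposition[OF lin bdd q m m_meas that])
  have fin: "?R ?m < \<infinity>"
    unfolding IPR_def m by (rule integrated_square_loss_mean_finite[OF lin bdd \<open>prob_space M\<close> q])
  have diff: "enn2ereal (?R t) - enn2ereal (?R ?m) = enn2ereal (?E t)"
    if "t \<in> borel_measurable M" for t
    unfolding decomp[OF that] using fin by (rule enn2ereal_add_diff_cancel)
  have finite_case: "integrable M (\<lambda>g. (norm (B *v (t g - ?m g)))\<^sup>2) \<and>
      enn2real (?R t) - enn2real (?R ?m) = (\<integral>g. (norm (B *v (t g - ?m g)))\<^sup>2 \<partial>M)"
    if t: "t \<in> borel_measurable M" and "?R t < \<infinity>" for t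
  proof -
    have E: "?E t < \<infinity>"
      using \<open>?R t < \<infinity>\<close> decomp[OF t] by simp
    have "(*v) B \<in> borel_measurable borel"
      by (intro borel_measurable_continuous_onI linear_continuous_on lin)
    then have meas: "(\<lambda>g. (norm (B *v (t g - ?m g)))\<^sup>2) \<in> borel_measurable M"
      using t m_meas by measurable
    then have "integrable M (\<lambda>g. (norm (B *v (t g - ?m g)))\<^sup>2)"
      using E by (intro integrableI_nonneg) auto
    moreover have "(\<integral>g. (norm (B *v (t g - ?m g)))\<^sup>2 \<partial>M) = enn2real (?E t)"
      using meas by (intro integral_eq_nn_integral) auto
    \<comment> \<open>Since \<open>enn2real\<close> sends infinity to zero, it is additive only on
      finite arguments, hence the use of \<open>E\<close> and \<open>fin\<close>.\<close>
    moreover have "enn2real (?R t) = enn2real (?E t) + enn2real (?R ?m)"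
      unfolding decomp[OF t] using E fin by (intro enn2real_plus) auto
    ultimately show ?thesis
      by simp
  qed
  have "is_Bayes_rule V (\<pi> lam) B M ?m"
    unfolding is_Bayes_rule_def
  proof (intro conjI m_meas ballI)
    \<comment> \<open>The excess \<open>?E t\<close> is a nonnegative summand, so the inequality
      also covers infinite risk.\<close>
    show "?R ?m \<le> ?R t" if "t \<in> borel_measurable M" for t
      unfolding decomp[OF that] by simp
  qed
  then show ?thesis
    using fin diff finite_case by simp
qed

end
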